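(* Let $m_1,\dots,m_4$ be positive masses and let $\mathbf q=(\mathbf q_1,\mathbf q_2,\mathbf q_3,\mathbf q_4)$ be a configuration on $\mathbb S^2$ with $d_{ij}\in(0,\pi)$ for all $i\neq j$. Then $\mathbf q$ is a Dziobek equilibrium configuration of the curved 4-body problem if and only if $$\sin d_{12}\sin d_{34}=\sin d_{13}\sin d_{24}=\sin d_{14}\sin d_{23},$$ $\Delta_4\neq0$, and the masses satisfy $$(m_1,m_2,m_3,m_4)=\left(\frac{\sin^3 d_{12}\,\Delta_1}{\sin^3 d_{24}\,\Delta_4},\ \frac{\sin^3 d_{12}\,\Delta_2}{\sin^3 d_{14}\,\Delta_4},\ \frac{\sin^3 d_{13}\,\Delta_3}{\sin^3 d_{14}\,\Delta_4},\ 1\right)m_4.$$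
   Context: $\mathbb S^2$ is the unit sphere of $\mathbb R^3$; $d_{ij}\in[0,\pi]$ is the geodesic distance, $\cos d_{ij}=\mathbf q_i\cdot\mathbf q_j$. The curved $N$-body potential is $V(\mathbf q)=-\sum_{1\le i<j\le N}m_im_j\cot d_{ij}$ (here $N=4$), defined when all $d_{ij}\in(0,\pi)$. An equilibrium configuration is a critical point of $V$, i.e. a configuration with $\sum_{j\ne i}\frac{m_im_j}{\sin^3 d_{ij}}[\mathbf q_j-\cos d_{ij}\,\mathbf q_i]=0$ for every $i$. A configuration of $N$ bodies is Dziobek if $\operatorname{rank}(\mathbf q_1,\dots,\mathbf q_N)=N-1$; a Dziobek equilibrium configuration is an equilibrium configuration that is Dziobek. $\Delta_k=(-1)^{k+1}\det X_k$, where $X_k$ is the $3\times3$ matrix obtained from $X=[\mathbf q_1,\dots,\mathbf q_4]$ (columns $\mathbf q_i\in\mathbb R^3$) by deleting the $k$-th column. *)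

theory Defs
  imports "HOL-Analysis.Analysis"
begin

definition geo_dist :: "real^3^'n \<Rightarrow> 'n \<Rightarrow> 'n \<Rightarrow> real" where
  "geo_dist q i j = arccos (q $ i \<bullet> q $ j)"

definition sphere_configs :: "(real^3^'n) set" where
  "sphere_configs = {q. (\<forall>i. q $ i \<in> sphere 0 1) \<and>
     (\<forall>i j. i \<noteq> j \<longrightarrow> geo_dist q i j \<in> {0<..<pi})}"

text \<open>The linear order on the index type only serves to list every unordered pair of bodies once;
  the summand is symmetric, so the value does not depend on the order.\<close>

definition potential :: "real^'n::{finite,linorder} \<Rightarrow> real^3^'n::{finite,linorder} \<Rightarrow> real" where
  "potential m q = - (\<Sum>(i, j)\<in>{(i, j). i < j}. m $ i * m $ j * cot (geo_dist q i j))"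

text \<open>Critical points of the potential on its domain, an open subset of a product of spheres: for
  a function on a submanifold of Euclidean space, the intrinsic differential at \<open>q\<close> vanishes iff the
  zero map is a derivative at \<open>q\<close> within the submanifold. Lemma \<open>equilibrium_iff\<close>
  below gives the equivalent explicit equations.\<close>

definition equilibrium :: "real^'n::{finite,linorder} \<Rightarrow> real^3^'n::{finite,linorder} \<Rightarrow> bool" where
  "equilibrium m q \<longleftrightarrow> q \<in> sphere_configs \<and>
     (potential m has_derivative (\<lambda>_. 0)) (at q within sphere_configs)"

text \<open>The rows of \<open>q\<close> are the bodies, so the matrix with columns \<open>q $ i\<close> is \<open>transpose q\<close>.\<close>

definition dziobek :: "real^3^'n \<Rightarrow> bool" where
  "dziobek q \<longleftrightarrow> rank (transpose q) = CARD('n) - 1"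

definition delete_column :: "4 \<Rightarrow> real^4^3 \<Rightarrow> real^3^3" where
  "delete_column k X =
     transpose (vector (map (\<lambda>i. column i X) (filter (\<lambda>i. i \<noteq> k) [1, 2, 3, 4])))"

text \<open>The index is a natural number in \<open>{1..4}\<close> so that the sign can be read off; the type \<open>4\<close>
  is cyclic, with \<open>4 = 0\<close>.\<close>

definition Delta :: "real^3^4 \<Rightarrow> nat \<Rightarrow> real" where
  "Delta q k = (-1) ^ (k + 1) * det (delete_column (of_nat k) (transpose q))"

lemma Delta_simps:
  "Delta q 1 = det (transpose (vector [q $ 2, q $ 3, q $ 4]))"
  "Delta q 2 = - det (transpose (vector [q $ 1, q $ 3, q $ 4]))"
  "Delta q 3 = det (transpose (vector [q $ 1, q $ 2, q $ 4]))"
  "Delta q 4 = - det (transpose (vector [q $ 1, q $ 2, q $ 3]))"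
  by (simp_all add: Delta_def delete_column_def column_def transpose_def)

lemma vector_4_nth:
  "vector [a, b, c, e] $ (1::4) = a" "vector [a, b, c, e] $ (2::4) = b"
  "vector [a, b, c, e] $ (3::4) = c" "vector [a, b, c, e] $ (4::4) = e"
  by (simp_all add: vector_def)

lemma sphere_configs_inner:
  assumes "q \<in> sphere_configs"
  shows "q $ i \<bullet> q $ i = 1" "i \<noteq> j \<Longrightarrow> \<bar>q $ i \<bullet> q $ j\<bar> < 1"
proof -
  have n: "norm (q $ i) = 1" for i using assms by (auto simp: sphere_configs_def)
  then show "q $ i \<bullet> q $ i = 1" by (simp add: dot_square_norm)
  assume ij: "i \<noteq> j"
  have le: "\<bar>q $ i \<bullet> q $ j\<bar> \<le> 1" using Cauchy_Schwarz_ineq2[of "q$i" "q$j"] n by simp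
  have "0 < arccos (q $ i \<bullet> q $ j)" "arccos (q $ i \<bullet> q $ j) < pi"
    using assms ij by (auto simp: sphere_configs_def geo_dist_def)
  then have "q $ i \<bullet> q $ j \<noteq> 1" "q $ i \<bullet> q $ j \<noteq> -1" by auto
  with le show "\<bar>q $ i \<bullet> q $ j\<bar> < 1" by linarith
qed

lemma sphere_configs_iff:
  "q \<in> sphere_configs \<longleftrightarrow>
     (\<forall>i. q $ i \<bullet> q $ i = 1) \<and> (\<forall>i j. i \<noteq> j \<longrightarrow> \<bar>q $ i \<bullet> q $ j\<bar> < 1)"
proof (intro iffI)
  assume "q \<in> sphere_configs"
  then show "(\<forall>i. q $ i \<bullet> q $ i = 1) \<and> (\<forall>i j. i \<noteq> j \<longrightarrow> \<bar>q $ i \<bullet> q $ j\<bar> < 1)"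
    using sphere_configs_inner by blast
next
  assume a: "(\<forall>i. q $ i \<bullet> q $ i = 1) \<and> (\<forall>i j. i \<noteq> j \<longrightarrow> \<bar>q $ i \<bullet> q $ j\<bar> < 1)"
  then have "norm (q $ i) = 1" for i by (simp add: norm_eq_1)
  moreover have "0 < arccos (q $ i \<bullet> q $ j) \<and> arccos (q $ i \<bullet> q $ j) < pi" if "i \<noteq> j" for i j
    using a that arccos_lt_bounded[of "q $ i \<bullet> q $ j"] by (auto simp: abs_less_iff)
  ultimately show "q \<in> sphere_configs"
    by (simp add: sphere_configs_def geo_dist_def)
qed

lemma cot_arccos_deriv:
  fixes x :: real
  assumes "\<bar>x\<bar> < 1"
  shows "((\<lambda>x. cot (arccos x)) has_real_derivative 1 / sin (arccos x) ^ 3) (at x)"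
proof -
  have s: "sin (arccos x) = sqrt (1 - x\<^sup>2)" using assms by (simp add: sin_arccos_abs)
  have pos: "0 < 1 - x\<^sup>2" using assms by (simp add: abs_square_less_1)
  then have p: "0 < sqrt (1 - x\<^sup>2)" by simp
  have a: "(arccos has_real_derivative inverse (- sqrt (1 - x\<^sup>2))) (at x)"
    using assms by (intro DERIV_arccos) auto
  have c: "(cot has_real_derivative - inverse ((sin (arccos x))\<^sup>2)) (at (arccos x))"
    using p s by (intro DERIV_cot) auto
  have "((\<lambda>x. cot (arccos x)) has_real_derivative
      - inverse ((sin (arccos x))\<^sup>2) * inverse (- sqrt (1 - x\<^sup>2))) (at x)"
    by (rule DERIV_chain2[OF c a])
  then show ?thesis
    using p by (simp add: s power2_eq_square power3_eq_cube field_simps)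
qed

lemma sum_pairs:
  fixes f :: "'n::{finite,linorder} \<Rightarrow> 'n \<Rightarrow> real"
  shows "(\<Sum>(i, j)\<in>{(i, j). i < j}. f i j + f j i) = (\<Sum>i\<in>UNIV. \<Sum>j\<in>-{i}. f i j)"
proof -
  let ?A = "{(i, j). i < j} :: ('n \<times> 'n) set" and ?B = "{(i, j). j < i} :: ('n \<times> 'n) set"
  have "(\<Sum>(i, j)\<in>?A. f j i) = (\<Sum>(i, j)\<in>?B. f i j)"
    by (rule sum.reindex_bij_witness[of _ prod.swap prod.swap]) auto
  then have "(\<Sum>(i, j)\<in>?A. f i j + f j i) = (\<Sum>(i, j)\<in>?A. f i j) + (\<Sum>(i, j)\<in>?B. f i j)"
    by (simp add: sum.distrib case_prod_unfold)
  also have "\<dots> = (\<Sum>(i, j)\<in>?A \<union> ?B. f i j)"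
    by (rule sum.union_disjoint[symmetric]) auto
  also have "?A \<union> ?B = Sigma UNIV (\<lambda>i. -{i})" by auto
  also have "(\<Sum>(i, j)\<in>Sigma UNIV (\<lambda>i. -{i}). f i j) = (\<Sum>i\<in>UNIV. \<Sum>j\<in>-{i}. f i j)"
    by (rule sum.Sigma[symmetric]) auto
  finally show ?thesis .
qed

text \<open>Minus the gradient of the potential extended to a neighbourhood of \<open>q\<close> in the ambient
  Euclidean space, body by body.\<close>

definition ambient_force :: "real^'n \<Rightarrow> real^3^'n \<Rightarrow> 'n \<Rightarrow> real^3" where
  "ambient_force m q i = (\<Sum>j\<in>-{i}. (m $ i * m $ j / sin (geo_dist q i j) ^ 3) *\<^sub>R q $ j)"

lemma potential_has_derivative:
  fixes m :: "real^'n::{finite,linorder}"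
  assumes "q \<in> sphere_configs"
  shows "(potential m has_derivative (\<lambda>v. - (\<Sum>i\<in>UNIV. v $ i \<bullet> ambient_force m q i))) (at q)"
proof -
  have t: "((\<lambda>x. m $ i * m $ j * cot (arccos (x $ i \<bullet> x $ j))) has_derivative
      (\<lambda>v. m $ i * m $ j / sin (geo_dist q i j) ^ 3 * (v $ i \<bullet> q $ j)
         + m $ j * m $ i / sin (geo_dist q j i) ^ 3 * (v $ j \<bullet> q $ i))) (at q)" if "i < j" for i j
  proof -
    have lt: "\<bar>q $ i \<bullet> q $ j\<bar> < 1" using sphere_configs_inner(2)[OF assms] that by simp
    have nth: "((\<lambda>x::(real^3, 'n) vec. x $ k) has_derivative (\<lambda>v. v $ k)) (at q)" for k
      by (rule bounded_linear_imp_has_derivative) (rule bounded_linear_vec_nth)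
    have inn: "((\<lambda>x::(real^3, 'n) vec. x $ i \<bullet> x $ j) has_derivative
        (\<lambda>v. q $ i \<bullet> v $ j + v $ i \<bullet> q $ j)) (at q)"
      by (rule has_derivative_inner[OF nth nth])
    have "((\<lambda>x. cot (arccos (x $ i \<bullet> x $ j))) has_derivative
        (\<lambda>v. 1 / sin (arccos (q $ i \<bullet> q $ j)) ^ 3 * (q $ i \<bullet> v $ j + v $ i \<bullet> q $ j))) (at q)"
      by (rule has_derivative_compose[OF inn cot_arccos_deriv[OF lt, unfolded has_field_derivative_def]])
    from has_derivative_mult_right[OF this, of "m $ i * m $ j"] show ?thesis
      by (rule has_derivative_eq_rhs)
        (simp add: fun_eq_iff geo_dist_def inner_commute algebra_simps add_divide_distrib)
  qed
  have e: "potential m = (\<lambda>x. - (\<Sum>p\<in>{(i, j). i < j}.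
      m $ fst p * m $ snd p * cot (arccos (x $ fst p \<bullet> x $ snd p))))"
    by (simp add: fun_eq_iff potential_def geo_dist_def case_prod_unfold)
  have "(potential m has_derivative (\<lambda>v. - (\<Sum>p\<in>{(i, j). i < j}.
      m $ fst p * m $ snd p / sin (geo_dist q (fst p) (snd p)) ^ 3 * (v $ fst p \<bullet> q $ snd p)
       + m $ snd p * m $ fst p / sin (geo_dist q (snd p) (fst p)) ^ 3 * (v $ snd p \<bullet> q $ fst p)))) (at q)"
    unfolding e by (intro has_derivative_minus has_derivative_sum t) auto
  moreover have "(\<Sum>p\<in>{(i, j). i < j}.
      m $ fst p * m $ snd p / sin (geo_dist q (fst p) (snd p)) ^ 3 * (v $ fst p \<bullet> q $ snd p)
       + m $ snd p * m $ fst p / sin (geo_dist q (snd p) (fst p)) ^ 3 * (v $ snd p \<bullet> q $ fst p))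
     = (\<Sum>i\<in>UNIV. v $ i \<bullet> ambient_force m q i)" for v :: "(real^3, 'n) vec"
    using sum_pairs[of "\<lambda>i j. m $ i * m $ j / sin (geo_dist q i j) ^ 3 * (v $ i \<bullet> q $ j)"]
    by (simp add: case_prod_unfold ambient_force_def inner_sum_right)
  ultimately show ?thesis by simp
qed

lemma equilibrium_iff:
  fixes m :: "real^'n::{finite,linorder}"
  shows "equilibrium m q \<longleftrightarrow> q \<in> sphere_configs \<and>
    (\<forall>i. (\<Sum>j\<in>-{i}. (m $ i * m $ j / sin (geo_dist q i j) ^ 3) *\<^sub>R
       (q $ j - cos (geo_dist q i j) *\<^sub>R q $ i)) = 0)"
proof (cases "q \<in> sphere_configs")
  case q: True
  define G where "G i = ambient_force m q i - (ambient_force m q i \<bullet> q $ i) *\<^sub>R q $ i" for i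
  note q1 = sphere_configs_inner(1)[OF q]
  have cosd: "cos (geo_dist q i j) = q $ j \<bullet> q $ i" if "j \<noteq> i" for i j
    using sphere_configs_inner(2)[OF q, of i j] that
    by (simp add: geo_dist_def cos_arccos_abs inner_commute)
  have G: "(\<Sum>j\<in>-{i}. (m $ i * m $ j / sin (geo_dist q i j) ^ 3) *\<^sub>R
       (q $ j - cos (geo_dist q i j) *\<^sub>R q $ i)) = G i" for i
  proof -
    have "(\<Sum>j\<in>-{i}. (m $ i * m $ j / sin (geo_dist q i j) ^ 3) *\<^sub>R
         (q $ j - cos (geo_dist q i j) *\<^sub>R q $ i)) =
      (\<Sum>j\<in>-{i}. (m $ i * m $ j / sin (geo_dist q i j) ^ 3) *\<^sub>R
         (q $ j - (q $ j \<bullet> q $ i) *\<^sub>R q $ i))"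
      by (intro sum.cong refl) (simp add: cosd)
    also have "\<dots> = G i"
      by (simp add: G_def ambient_force_def inner_sum_left scaleR_sum_left
          scaleR_diff_right sum_subtractf)
    finally show ?thesis .
  qed
  let ?D = "\<lambda>v::(real^3, 'n) vec. - (\<Sum>i\<in>UNIV. v $ i \<bullet> ambient_force m q i)"
  note D = potential_has_derivative[OF q, of m]
  have "(potential m has_derivative (\<lambda>_. 0)) (at q within sphere_configs) \<longleftrightarrow> (\<forall>i. G i = 0)"
  proof
    assume z: "(potential m has_derivative (\<lambda>_. 0)) (at q within sphere_configs)"
    show "\<forall>i. G i = 0"
    proof
      fix i
      show "G i = 0"
      proof (rule ccontr)
        assume nz: "G i \<noteq> 0"
        define u where "u = G i /\<^sub>R norm (G i)"
        have qG: "q $ i \<bullet> G i = 0"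
          by (simp add: G_def inner_diff_right q1 inner_commute)
        have uu: "u \<bullet> u = 1" and qu: "q $ i \<bullet> u = 0"
          using nz qG by (simp_all add: u_def dot_square_norm power2_eq_square)
        define c where "c t = cos t *\<^sub>R q $ i + sin t *\<^sub>R u" for t :: real
        define \<gamma> where "\<gamma> t = q + axis i (c t - q $ i)" for t
        have \<gamma>_nth: "\<gamma> t $ k = (if k = i then c t else q $ k)" for t k
          by (simp add: \<gamma>_def axis_def)
        have \<gamma>0: "\<gamma> 0 = q" by (simp add: vec_eq_iff \<gamma>_nth c_def)
        have cc: "c t \<bullet> c t = 1" for t
          using q1 uu qu sin_cos_squared_add[of t]
          by (simp add: c_def inner_add_left inner_add_right inner_commute power2_eq_square)
        have c': "(c has_derivative (\<lambda>t. t *\<^sub>R u)) (at 0)"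
          unfolding c_def[abs_def] by (auto intro!: derivative_eq_intros)
        have bax: "bounded_linear (axis i :: real^3 \<Rightarrow> (real^3, 'n) vec)"
          by (rule linear_conv_bounded_linear[THEN iffD1])
            (auto intro!: linearI simp: axis_def vec_eq_iff)
        have \<gamma>': "(\<gamma> has_derivative (\<lambda>t. axis i (t *\<^sub>R u))) (at 0)"
          unfolding \<gamma>_def[abs_def]
          by (auto intro!: derivative_eq_intros bounded_linear.has_derivative[OF bax] c')
        have cont: "isCont \<gamma> 0" using \<gamma>' by (rule has_derivative_continuous)
        have ev: "\<forall>\<^sub>F t in at 0. \<gamma> t \<in> sphere_configs"
        proof -
          have "\<forall>\<^sub>F t in at 0. k \<noteq> l \<longrightarrow> \<bar>\<gamma> t $ k \<bullet> \<gamma> t $ l\<bar> < 1" for k l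
          proof (cases "k = l")
            case False
            have "((\<lambda>t. \<bar>\<gamma> t $ k \<bullet> \<gamma> t $ l\<bar>) \<longlongrightarrow> \<bar>\<gamma> 0 $ k \<bullet> \<gamma> 0 $ l\<bar>) (at 0)"
              using cont unfolding isCont_def by (intro tendsto_intros)
            moreover have "\<bar>\<gamma> 0 $ k \<bullet> \<gamma> 0 $ l\<bar> < 1"
              using sphere_configs_inner(2)[OF q False] by (simp add: \<gamma>0)
            ultimately show ?thesis
              using order_tendstoD(2)[of "\<lambda>t. \<bar>\<gamma> t $ k \<bullet> \<gamma> t $ l\<bar>"] by (simp add: False)
          qed simp
          then have "\<forall>\<^sub>F t in at 0. \<forall>k l. k \<noteq> l \<longrightarrow> \<bar>\<gamma> t $ k \<bullet> \<gamma> t $ l\<bar> < 1"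
            by (intro eventually_all_finite)
          then show ?thesis
            by eventually_elim (auto simp: sphere_configs_iff \<gamma>_nth cc q1)
        qed
        then obtain S where S: "open S" "0 \<in> S" "\<And>t. t \<in> S \<Longrightarrow> t \<noteq> 0 \<Longrightarrow> \<gamma> t \<in> sphere_configs"
          unfolding eventually_at_topological by blast
        have sub: "\<gamma> ` S \<subseteq> sphere_configs" using S(3) q \<gamma>0 by (metis image_subsetI)
        have "((\<lambda>t. potential m (\<gamma> t)) has_derivative (\<lambda>_. 0)) (at 0 within S)"
          using has_derivative_in_compose[OF has_derivative_at_withinI[OF \<gamma>', of S], of "potential m" "\<lambda>_. 0"]
            has_derivative_subset[OF z sub] by (simp add: \<gamma>0)
        then have 1: "((\<lambda>t. potential m (\<gamma> t)) has_derivative (\<lambda>_. 0)) (at 0)"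
          by (simp add: at_within_open[OF S(2,1)])
        have 2: "((\<lambda>t. potential m (\<gamma> t)) has_derivative (\<lambda>t. ?D (axis i (t *\<^sub>R u)))) (at 0)"
          using has_derivative_compose[OF \<gamma>', of "potential m" ?D] D by (simp add: \<gamma>0)
        have "?D (axis i (1 *\<^sub>R u)) = 0"
          by (rule fun_cong[OF has_derivative_unique[OF 1 2], symmetric])
        then have "u \<bullet> ambient_force m q i = 0"
          by (simp add: axis_def if_distrib[of "\<lambda>x. x \<bullet> _"] cong: if_cong)
        then have "G i \<bullet> ambient_force m q i = 0" using nz by (simp add: u_def)
        then have "G i \<bullet> G i = 0"
          using qG by (simp add: G_def inner_diff_right inner_diff_left inner_commute)
        then show False using nz by simp
      qed
    qed
  next
    assume "\<forall>i. G i = 0"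
    then have F: "ambient_force m q i = (ambient_force m q i \<bullet> q $ i) *\<^sub>R q $ i" for i
      by (simp add: G_def)
    define a where "a i = ambient_force m q i \<bullet> q $ i" for i
    define W where "W x = potential m x + (\<Sum>i\<in>UNIV. a i / 2 * (x $ i \<bullet> x $ i))" for x
    have nth: "((\<lambda>x::(real^3, 'n) vec. x $ k) has_derivative (\<lambda>v. v $ k)) (at q)" for k
      by (rule bounded_linear_imp_has_derivative) (rule bounded_linear_vec_nth)
    have "(W has_derivative (\<lambda>v. ?D v + (\<Sum>i\<in>UNIV. a i / 2 * (q $ i \<bullet> v $ i + v $ i \<bullet> q $ i)))) (at q)"
      unfolding W_def[abs_def]
      by (intro has_derivative_add D has_derivative_sum has_derivative_mult_right
          has_derivative_inner nth)
    moreover have "?D v + (\<Sum>i\<in>UNIV. a i / 2 * (q $ i \<bullet> v $ i + v $ i \<bullet> q $ i)) = 0" for v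
    proof -
      have "v $ i \<bullet> ambient_force m q i = a i / 2 * (q $ i \<bullet> v $ i + v $ i \<bullet> q $ i)" for i
        by (subst F) (simp add: a_def inner_commute)
      then have "(\<Sum>i\<in>UNIV. v $ i \<bullet> ambient_force m q i) =
          (\<Sum>i\<in>UNIV. a i / 2 * (q $ i \<bullet> v $ i + v $ i \<bullet> q $ i))"
        by (rule sum.cong[OF refl])
      then show ?thesis by linarith
    qed
    ultimately have "(W has_derivative (\<lambda>_. 0)) (at q)" by simp
    then have "(W has_derivative (\<lambda>_. 0)) (at q within sphere_configs)"
      by (rule has_derivative_at_withinI)
    from has_derivative_diff[OF this has_derivative_const[of "\<Sum>i\<in>UNIV. a i / 2"]]
    have "((\<lambda>x. W x - (\<Sum>i\<in>UNIV. a i / 2)) has_derivative (\<lambda>_. 0)) (at q within sphere_configs)"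
      by simp
    then show "(potential m has_derivative (\<lambda>_. 0)) (at q within sphere_configs)"
      by (rule has_derivative_transform[rotated 2])
        (use q in \<open>auto simp: W_def sphere_configs_inner(1)\<close>)
  qed
  then show ?thesis using q by (simp add: equilibrium_def G)
qed (simp add: equilibrium_def)

end

theory Submission
  imports Defs
begin

text \<open>If the rank is three, the linear relations among \<open>q $ 1, \<dots>, q $ 4\<close> form the line spanned by
  the vector of the signed minors. The equilibrium equation of body \<open>i\<close> is such a relation, whose
  coefficients at \<open>j \<noteq> i\<close> are \<open>m\<^sub>i m\<^sub>j / sin\<^sup>3 d\<^sub>i\<^sub>j\<close>. Hence equilibrium means that
  \<open>m\<^sub>i m\<^sub>j / sin\<^sup>3 d\<^sub>i\<^sub>j = \<kappa> \<Delta>\<^sub>i \<Delta>\<^sub>j\<close> with one constant \<open>\<kappa>\<close>; comparing quotients of these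
  equations gives the sine conditions and the mass formulas.\<close>

text \<open>A vector over type \<open>4\<close> lets one index range over bodies, masses and minors
  alike; the index of \<open>Delta\<close> is a natural number.\<close>

definition minors :: "real^3^4 \<Rightarrow> real^4" where
  "minors q = vector [Delta q 1, Delta q 2, Delta q 3, Delta q 4]"

lemma minors_nth:
  "minors q $ 1 = Delta q 1" "minors q $ 2 = Delta q 2"
  "minors q $ 3 = Delta q 3" "minors q $ 4 = Delta q 4"
  by (simp_all add: minors_def vector_4_nth)

lemma minors_expand:
  "minors q $ 1 = q$2$1 * q$3$2 * q$4$3 + q$2$2 * q$3$3 * q$4$1 + q$2$3 * q$3$1 * q$4$2
     - q$2$1 * q$3$3 * q$4$2 - q$2$2 * q$3$1 * q$4$3 - q$2$3 * q$3$2 * q$4$1"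
  "minors q $ 2 = - (q$1$1 * q$3$2 * q$4$3 + q$1$2 * q$3$3 * q$4$1 + q$1$3 * q$3$1 * q$4$2
     - q$1$1 * q$3$3 * q$4$2 - q$1$2 * q$3$1 * q$4$3 - q$1$3 * q$3$2 * q$4$1)"
  "minors q $ 3 = q$1$1 * q$2$2 * q$4$3 + q$1$2 * q$2$3 * q$4$1 + q$1$3 * q$2$1 * q$4$2
     - q$1$1 * q$2$3 * q$4$2 - q$1$2 * q$2$1 * q$4$3 - q$1$3 * q$2$2 * q$4$1"
  "minors q $ 4 = - (q$1$1 * q$2$2 * q$3$3 + q$1$2 * q$2$3 * q$3$1 + q$1$3 * q$2$1 * q$3$2
     - q$1$1 * q$2$3 * q$3$2 - q$1$2 * q$2$1 * q$3$3 - q$1$3 * q$2$2 * q$3$1)"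
  unfolding minors_nth Delta_simps det_transpose by (simp_all add: det_3)

text \<open>Each coordinate is, up to sign, the Laplace expansion of a 4 by 4 determinant with a
  repeated row.\<close>

lemma sum_minors: "(\<Sum>i\<in>UNIV. minors q $ i *\<^sub>R q $ i) = 0"
  unfolding vec_eq_iff forall_3
  by (simp add: sum_4 minors_expand algebra_simps)

text \<open>Cramer's rule: eliminating two coefficients from the three coordinate equations relates
  the other two. Without division it also covers rank below three, where all minors vanish.\<close>

lemma relation_proportional_minors:
  assumes "(\<Sum>i\<in>UNIV. a $ i *\<^sub>R q $ i) = 0"
  shows "a $ i * minors q $ j = a $ j * minors q $ i"
proof -
  have r: "a$1 * q$1$k + a$2 * q$2$k + a$3 * q$3$k + a$4 * q$4$k = 0" for k
    using arg_cong[OF assms, of "\<lambda>x. x $ k"] by (simp add: sum_4)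
  note r' = r[of 1] r[of 2] r[of 3]
  have "a$1 * minors q $ 2 = a$2 * minors q $ 1" "a$1 * minors q $ 3 = a$3 * minors q $ 1"
    "a$1 * minors q $ 4 = a$4 * minors q $ 1" "a$2 * minors q $ 3 = a$3 * minors q $ 2"
    "a$2 * minors q $ 4 = a$4 * minors q $ 2" "a$3 * minors q $ 4 = a$4 * minors q $ 3"
    unfolding minors_expand using r' by algebra+
  then show ?thesis
    using exhaust_4[of i] exhaust_4[of j] by auto
qed

text \<open>The required rank, 4 - 1 = 3, is the number of columns of \<open>q\<close>, so it is
  full column rank.\<close>

lemma dziobek_iff_inj:
  fixes q :: "real^3^4"
  shows "dziobek q \<longleftrightarrow> inj ((*v) q)"
  by (simp add: dziobek_def rank_transpose flip: full_rank_injective)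

lemma dziobek_if_Delta_4:
  assumes "Delta q 4 \<noteq> 0"
  shows "dziobek q"
  unfolding dziobek_iff_inj
proof (rule injI)
  fix x y assume eq: "q *v x = q *v y"
  define A :: "real^3^3" where "A = vector [q $ 1, q $ 2, q $ 3]"
  have "A *v x = A *v y"
    using eq by (simp add: vec_eq_iff forall_3 forall_4 A_def matrix_vector_mul_component)
  moreover have "invertible A"
    using assms by (simp add: A_def invertible_det_nz Delta_simps det_transpose)
  ultimately show "x = y"
    using inj_matrix_vector_mult by (metis injD)
qed

text \<open>If both vanished, \<open>q $ 3\<close> and \<open>q $ 4\<close> would lie in the plane
  of the independent vectors \<open>q $ 1\<close> and \<open>q $ 2\<close>. This supplies one
  nonzero minor, from which equilibrium yields others.\<close>

lemma Delta_3_4_nonzero_if_dziobek: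
  assumes "q \<in> sphere_configs" "dziobek q"
  shows "Delta q 3 \<noteq> 0 \<or> Delta q 4 \<noteq> 0"
proof (rule ccontr)
  assume n: "\<not> ?thesis"
  \<comment> \<open>The products of this normal with \<open>q $ 3\<close> and \<open>q $ 4\<close>
    are \<open>- Delta q 4\<close> and \<open>Delta q 3\<close>.\<close>
  define w where "w = cross3 (q $ 1) (q $ 2)"
  have "w \<bullet> q $ i = 0" for i
  proof -
    have "w \<bullet> q $ 1 = 0" "w \<bullet> q $ 2 = 0" "w \<bullet> q $ 3 = 0" "w \<bullet> q $ 4 = 0"
      using n minors_expand(3,4)[of q]
      by (simp_all add: w_def cross3_simps inner_vec_def sum_3 minors_nth)
    then show ?thesis using exhaust_4[of i] by auto
  qed
  then have "q *v w = q *v 0"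
    by (simp add: vec_eq_iff[of "q *v w"] matrix_vector_mul_component inner_commute)
  then have "w = 0"
    using assms(2) by (simp only: dziobek_iff_inj) (rule injD)
  \<comment> \<open>Lagrange's identity for unit vectors: squared norm of the cross product plus
    squared inner product is 1.\<close>
  then have "(q $ 1 \<bullet> q $ 2)\<^sup>2 = 1"
    using norm_cross_dot[of "q $ 1" "q $ 2"] sphere_configs_inner(1)[OF assms(1)]
    by (simp add: w_def norm_eq_1[THEN iffD2])
  moreover have "\<bar>q $ 1 \<bullet> q $ 2\<bar> < 1"
    by (rule sphere_configs_inner(2)[OF assms(1)]) simp
  ultimately show False
    by (simp flip: abs_square_less_1)
qed

text \<open>The cosine terms are all multiples of \<open>q $ i\<close>; they merge into the
  coefficient \<open>a $ i\<close>, whose value is left open.\<close>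

lemma equilibrium_relation:
  assumes "equilibrium m q"
  shows "\<exists>a. (\<Sum>j\<in>UNIV. a $ j *\<^sub>R q $ j) = 0 \<and>
    (\<forall>j. j \<noteq> i \<longrightarrow> a $ j = m $ i * m $ j / sin (geo_dist q i j) ^ 3)"
proof -
  let ?f = "\<lambda>j. m $ i * m $ j / sin (geo_dist q i j) ^ 3"
  define l where "l = (\<Sum>j\<in>-{i}. ?f j * cos (geo_dist q i j))"
  define a where "a = (\<chi> j. if j = i then - l else ?f j)"
  have "(\<Sum>j\<in>-{i}. ?f j *\<^sub>R q $ j) - l *\<^sub>R q $ i =
      (\<Sum>j\<in>-{i}. ?f j *\<^sub>R (q $ j - cos (geo_dist q i j) *\<^sub>R q $ i))"
    by (simp add: l_def scaleR_sum_left scaleR_diff_right sum_subtractf)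
  also have "\<dots> = 0"
    using assms by (simp add: equilibrium_iff)
  finally have "(\<Sum>j\<in>-{i}. ?f j *\<^sub>R q $ j) - l *\<^sub>R q $ i = 0" .
  moreover have "(\<Sum>j\<in>UNIV. a $ j *\<^sub>R q $ j) = - l *\<^sub>R q $ i + (\<Sum>j\<in>-{i}. ?f j *\<^sub>R q $ j)"
    by (simp add: sum.remove[of UNIV i] a_def Compl_eq_Diff_UNIV)
  ultimately have "(\<Sum>j\<in>UNIV. a $ j *\<^sub>R q $ j) = 0"
    by simp
  then show ?thesis
    by (intro exI[of _ a]) (simp add: a_def)
qed

text \<open>The factor \<open>k * D $ i\<close> comes out of the force on body \<open>i\<close>; by
  the relation, what remains is a multiple of \<open>q $ i\<close>, so its tangential part is
  zero.\<close>

lemma equilibrium_if_rank_one: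
  assumes q: "q \<in> sphere_configs"
    and rel: "(\<Sum>j\<in>UNIV. D $ j *\<^sub>R q $ j) = 0"
    and k: "\<And>i j. i \<noteq> j \<Longrightarrow> m $ i * m $ j / sin (geo_dist q i j) ^ 3 = k * D $ i * D $ j"
  shows "equilibrium m q"
  unfolding equilibrium_iff
proof (intro conjI allI q)
  fix i
  have cosd: "cos (geo_dist q i j) = q $ j \<bullet> q $ i" if "j \<noteq> i" for j
    using sphere_configs_inner(2)[OF q, of i j] that
    by (simp add: geo_dist_def cos_arccos_abs inner_commute)
  have r: "(\<Sum>j\<in>-{i}. D $ j *\<^sub>R q $ j) = - D $ i *\<^sub>R q $ i"
    using rel by (simp add: sum.remove[of UNIV i] Compl_eq_Diff_UNIV eq_neg_iff_add_eq_0 add.commute)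
  have "(\<Sum>j\<in>-{i}. D $ j * (q $ j \<bullet> q $ i)) = (\<Sum>j\<in>-{i}. D $ j *\<^sub>R q $ j) \<bullet> q $ i"
    by (simp add: inner_sum_left)
  also have "\<dots> = - D $ i"
    by (simp add: r sphere_configs_inner(1)[OF q])
  finally have p: "(\<Sum>j\<in>-{i}. D $ j * (q $ j \<bullet> q $ i)) = - D $ i" .
  have "(\<Sum>j\<in>-{i}. (m $ i * m $ j / sin (geo_dist q i j) ^ 3) *\<^sub>R
       (q $ j - cos (geo_dist q i j) *\<^sub>R q $ i)) =
    (\<Sum>j\<in>-{i}. (k * D $ i) *\<^sub>R (D $ j *\<^sub>R q $ j - (D $ j * (q $ j \<bullet> q $ i)) *\<^sub>R q $ i))"
    by (intro sum.cong refl) (simp add: k cosd scaleR_diff_right)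
  also have "\<dots> = (k * D $ i) *\<^sub>R ((\<Sum>j\<in>-{i}. D $ j *\<^sub>R q $ j)
      - (\<Sum>j\<in>-{i}. D $ j * (q $ j \<bullet> q $ i)) *\<^sub>R q $ i)"
    by (simp add: scaleR_sum_left sum_subtractf flip: scaleR_sum_right)
  also have "\<dots> = 0"
    by (simp add: r p)
  finally show "(\<Sum>j\<in>-{i}. (m $ i * m $ j / sin (geo_dist q i j) ^ 3) *\<^sub>R
       (q $ j - cos (geo_dist q i j) *\<^sub>R q $ i)) = 0" .
qed

theorem corollary2:
  fixes m :: "real^4" and q :: "real^3^4"
  assumes "\<And>i. 0 < m $ i"
    and "q \<in> sphere_configs"
  shows "dziobek q \<and> equilibrium m q \<longleftrightarrow>
    sin (geo_dist q 1 2) * sin (geo_dist q 3 4) = sin (geo_dist q 1 3) * sin (geo_dist q 2 4) \<and>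
    sin (geo_dist q 1 3) * sin (geo_dist q 2 4) = sin (geo_dist q 1 4) * sin (geo_dist q 2 3) \<and>
    Delta q 4 \<noteq> 0 \<and>
    m = m $ 4 *\<^sub>R vector
      [sin (geo_dist q 1 2) ^ 3 * Delta q 1 / (sin (geo_dist q 2 4) ^ 3 * Delta q 4),
       sin (geo_dist q 1 2) ^ 3 * Delta q 2 / (sin (geo_dist q 1 4) ^ 3 * Delta q 4),
       sin (geo_dist q 1 3) ^ 3 * Delta q 3 / (sin (geo_dist q 1 4) ^ 3 * Delta q 4),
       1]"
proof -
  define s where "s i j = sin (geo_dist q i j)" for i j
  have s_pos: "0 < s i j" if "i \<noteq> j" for i j
    using assms(2) that by (auto simp: s_def sphere_configs_def intro!: sin_gt_zero)
  have s_sym: "s i j = s j i" for i j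
    by (simp add: s_def geo_dist_def inner_commute)
  let ?sines = "s 1 2 * s 3 4 = s 1 3 * s 2 4 \<and> s 1 3 * s 2 4 = s 1 4 * s 2 3"
  let ?masses = "m $ 1 = m $ 4 * (s 1 2 ^ 3 * Delta q 1 / (s 2 4 ^ 3 * Delta q 4)) \<and>
    m $ 2 = m $ 4 * (s 1 2 ^ 3 * Delta q 2 / (s 1 4 ^ 3 * Delta q 4)) \<and>
    m $ 3 = m $ 4 * (s 1 3 ^ 3 * Delta q 3 / (s 1 4 ^ 3 * Delta q 4))"
  have "dziobek q \<and> equilibrium m q \<longleftrightarrow> ?sines \<and> Delta q 4 \<noteq> 0 \<and> ?masses"
  proof (intro iffI; elim conjE)
    assume dz: "dziobek q" and eq: "equilibrium m q"
    \<comment> \<open>Bodies \<open>j\<close> and \<open>l\<close> are compared in the equation of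
      body \<open>i\<close>, where the common factor \<open>m $ i\<close> cancels.\<close>
    have ratio: "m $ j * s i l ^ 3 * minors q $ l = m $ l * s i j ^ 3 * minors q $ j"
      if "j \<noteq> i" "l \<noteq> i" for i j l
    proof -
      obtain a where a: "(\<Sum>j\<in>UNIV. a $ j *\<^sub>R q $ j) = 0"
        "\<And>j. j \<noteq> i \<Longrightarrow> a $ j = m $ i * m $ j / s i j ^ 3"
        using equilibrium_relation[OF eq, of i] unfolding s_def by blast
      have "m $ i * m $ j / s i j ^ 3 * minors q $ l = m $ i * m $ l / s i l ^ 3 * minors q $ j"
        using relation_proportional_minors[OF a(1), of j l] by (simp add: a(2) that)
      then show ?thesis
        using assms(1)[of i] s_pos[of i j] s_pos[of i l] that by (simp add: field_simps)
    qed
    have nz: "minors q $ j \<noteq> 0" if "minors q $ l \<noteq> 0" "j \<noteq> i" "l \<noteq> i" for i j l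
      using ratio[of j i l] that assms(1)[of j] s_pos[of i l] by auto
    have nz4: "minors q $ 4 \<noteq> 0"
      using Delta_3_4_nonzero_if_dziobek[OF assms(2) dz] nz[of 3 4 1] by (auto simp: minors_nth)
    have nz3: "minors q $ 3 \<noteq> 0" and nz2: "minors q $ 2 \<noteq> 0"
      using nz[OF nz4, of 3 1] nz[OF nz4, of 2 1] by auto
    note pos = s_pos[of 1 2] s_pos[of 1 3] s_pos[of 1 4] s_pos[of 2 3] s_pos[of 2 4] s_pos[of 3 4]
    note sym = s_sym[of 2 1] s_sym[of 3 1] s_sym[of 4 1] s_sym[of 3 2] s_sym[of 4 2] s_sym[of 4 3]
    have cube: "x = y" if "x ^ 3 = y ^ 3" "0 < x" "0 < y" for x y :: real
      using that by (metis less_imp_le power_eq_iff_eq_base zero_less_numeral)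
    \<comment> \<open>The first three are the mass formulas without denominators. \<open>p4\<close>
      and \<open>p5\<close> compute the ratios of \<open>m $ 3\<close> and \<open>m $ 2\<close> to
      \<open>m $ 4\<close> again, from the equations of bodies 2 and 3; agreement with
      \<open>p3\<close> and \<open>p2\<close> gives the sine conditions.\<close>
    have p1: "m $ 1 * s 2 4 ^ 3 * minors q $ 4 = m $ 4 * s 1 2 ^ 3 * minors q $ 1"
      and p2: "m $ 2 * s 1 4 ^ 3 * minors q $ 4 = m $ 4 * s 1 2 ^ 3 * minors q $ 2"
      and p3: "m $ 3 * s 1 4 ^ 3 * minors q $ 4 = m $ 4 * s 1 3 ^ 3 * minors q $ 3"
      and p4: "m $ 3 * s 2 4 ^ 3 * minors q $ 4 = m $ 4 * s 2 3 ^ 3 * minors q $ 3"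
      and p5: "m $ 2 * s 3 4 ^ 3 * minors q $ 4 = m $ 4 * s 2 3 ^ 3 * minors q $ 2"
      using ratio[of 1 2 4] ratio[of 2 1 4] ratio[of 3 1 4] ratio[of 3 2 4] ratio[of 2 3 4]
      by (simp_all add: sym)
    have cancel: "(x * v) ^ 3 = (u * y) ^ 3"
      if "c * x ^ 3 * d = e * y ^ 3 * f" "c * u ^ 3 * d = e * v ^ 3 * f" "c * d * e * f \<noteq> 0"
      for c d e f x y u v :: real
    proof -
      have "(c * x ^ 3 * d) * (e * v ^ 3 * f) = (e * y ^ 3 * f) * (c * u ^ 3 * d)"
        by (simp add: that)
      then have "(c * d * e * f) * ((x * v) ^ 3) = (c * d * e * f) * ((u * y) ^ 3)"
        by (simp add: power_mult_distrib algebra_simps)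
      then show ?thesis
        using that(3) by (metis mult_left_cancel)
    qed
    have "s 1 4 * s 2 3 = s 2 4 * s 1 3"
      using assms(1)[of 3] assms(1)[of 4] nz3 nz4 pos
      by (intro cube[OF cancel[OF p3 p4]]) auto
    moreover have "s 1 4 * s 2 3 = s 3 4 * s 1 2"
      using assms(1)[of 2] assms(1)[of 4] nz2 nz4 pos
      by (intro cube[OF cancel[OF p2 p5]]) auto
    ultimately have ?sines by (simp add: mult.commute)
    moreover have ?masses
      using p1 p2 p3 nz4 pos by (simp add: field_simps minors_nth)
    ultimately show "?sines \<and> Delta q 4 \<noteq> 0 \<and> ?masses"
      using nz4 by (simp add: minors_nth)
  next
    assume e1: "s 1 2 * s 3 4 = s 1 3 * s 2 4" and e2: "s 1 3 * s 2 4 = s 1 4 * s 2 3"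
      and D4: "Delta q 4 \<noteq> 0"
      and m1: "m $ 1 = m $ 4 * (s 1 2 ^ 3 * Delta q 1 / (s 2 4 ^ 3 * Delta q 4))"
      and m2: "m $ 2 = m $ 4 * (s 1 2 ^ 3 * Delta q 2 / (s 1 4 ^ 3 * Delta q 4))"
      and m3: "m $ 3 = m $ 4 * (s 1 3 ^ 3 * Delta q 3 / (s 1 4 ^ 3 * Delta q 4))"
    note pos = s_pos[of 1 2] s_pos[of 1 3] s_pos[of 1 4] s_pos[of 2 3] s_pos[of 2 4] s_pos[of 3 4]
    \<comment> \<open>The value is read off from the pair 1, 2 after inserting the mass
      formulas.\<close>
    define k where "k = (m $ 4)\<^sup>2 * s 1 2 ^ 3 / (s 1 4 ^ 3 * s 2 4 ^ 3 * (Delta q 4)\<^sup>2)"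
    \<comment> \<open>These two sines do not occur in the mass formulas; the sine conditions bring
      the pairs 3, 4 and 2, 3 to the same \<open>k\<close>.\<close>
    have s34: "s 3 4 = s 1 3 * s 2 4 / s 1 2" and s23: "s 2 3 = s 1 3 * s 2 4 / s 1 4"
      using e1 e2 pos by (simp_all add: field_simps)
    have k: "m $ 1 * m $ 2 / s 1 2 ^ 3 = k * minors q $ 1 * minors q $ 2"
      "m $ 1 * m $ 3 / s 1 3 ^ 3 = k * minors q $ 1 * minors q $ 3"
      "m $ 1 * m $ 4 / s 1 4 ^ 3 = k * minors q $ 1 * minors q $ 4"
      "m $ 2 * m $ 3 / s 2 3 ^ 3 = k * minors q $ 2 * minors q $ 3"
      "m $ 2 * m $ 4 / s 2 4 ^ 3 = k * minors q $ 2 * minors q $ 4"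
      "m $ 3 * m $ 4 / s 3 4 ^ 3 = k * minors q $ 3 * minors q $ 4"
      unfolding k_def m1 m2 m3 minors_nth s34 s23 using pos D4
      by (simp_all add: divide_simps power_mult_distrib power2_eq_square)
    have "m $ i * m $ j / s i j ^ 3 = k * minors q $ i * minors q $ j" if "i \<noteq> j" for i j
      using exhaust_4[of i] exhaust_4[of j] that k
        s_sym[of 2 1] s_sym[of 3 1] s_sym[of 4 1] s_sym[of 3 2] s_sym[of 4 2] s_sym[of 4 3]
      by (auto simp: mult_ac)
    then have "equilibrium m q"
      unfolding s_def by (rule equilibrium_if_rank_one[OF assms(2) sum_minors])
    with dziobek_if_Delta_4[OF D4] show "dziobek q \<and> equilibrium m q" ..
  qed
  then show ?thesis
    by (simp add: s_def vec_eq_iff[of m] forall_4 vector_4_nth)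
qed

end
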